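(* The difference scheme $$\mathbb{P}^{(\theta)}_{(\omega)}(\Delta_{0t_{j+1}})y_i=\Lambda y_i^{j+1}+\varphi_i^{j+1},\quad i=1,\dots,N-1,\ j=0,1,\dots,j_0-1,$$ $$y_0^j=0,\quad y_N^j=0,\quad j=0,1,\dots,j_0,\qquad y_i^0=u_0(x_i),\quad i=0,1,\dots,N,$$ is absolutely stable, and its solution satisfies (for all mesh steps $h=l/N$, $\tau=T/j_0$, with no restriction relating them, and every $j=0,1,\dots,j_0-1$) the a priori estimate $$\int_\alpha^\beta\sum_{r=1}^m\Big(\frac{\omega_r(x_i,\gamma)}{\Gamma(2-\theta_r(x_i,\gamma))},\ \sum_{s=0}^{j}\big(t_{j-s+1}^{1-\theta_r(x_i,\gamma)}-t_{j-s}^{1-\theta_r(x_i,\gamma)}\big)(y_i^{s+1})^2\Big)d\gamma+c_1\sum_{s=0}^{j}\|y_{\bar x}^{s+1}]|_0^2\,\tau$$ $$\le\frac{l^2}{2c_1}\sum_{s=0}^{j}\|\varphi^{s+1}\|_0^2\,\tau+\int_\alpha^\beta\sum_{r=1}^m\Big(\frac{\omega_r(x_i,\gamma)\,t_{j+1}^{1-\theta_r(x_i,\gamma)}}{\Gamma(2-\theta_r(x_i,\gamma))},\ u_0^2(x_i)\Big)d\gamma .$$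
   Context: Let $l,T>0$, $\alpha<\beta$ real, $m\ge1$ an integer, $\bar Q_T=[0,l]\times[0,T]$. For $r=1,\dots,m$: $\theta_r$ is continuous on $[0,l]\times[\alpha,\beta]$ with $0<\theta_r<1$; $\omega_r\ge0$ on $[0,l]\times[\alpha,\beta]$ with $\omega_r(x,\cdot)$ integrable on $[\alpha,\beta]$ for each $x$; and $\int_\alpha^\beta\sum_{r=1}^m\omega_r(x,\gamma)\,d\gamma>0$ for all $x\in[0,l]$. The functions $k,q,f$ on $\bar Q_T$ satisfy $0<c_1\le k\le c_2$, $q\ge0$ (constants $c_1,c_2$). Standing assumption of the difference setting: the problem $\int_\alpha^\beta\sum_{r=1}^m\omega_r(x,\gamma)\,\partial_{0t}^{\theta_r(x,\gamma)}u\,d\gamma=(ku_x)_x-qu+f$ for $0<x<l$, $0<t\le T$, $u(0,t)=u(l,t)=0$, $u(x,0)=u_0(x)$, where $\partial_{0t}^\theta u(x,t)=\frac1{\Gamma(1-\theta)}\int_0^t u_\eta(x,\eta)(t-\eta)^{-\theta}d\eta$ is the Caputo derivative, has a solution $u\in C^{4,3}(\bar Q_T)$ (continuous with its partial derivatives up to order $4$ in $x$ and $3$ in $t$), and $k,q,f,u_0$ are (at least) continuous. Grid: $x_i=ih$, $i=0,\dots,N$, $hN=l$; $t_j=j\tau$, $j=0,\dots,j_0$, $\tau j_0=T$; $x_{i-1/2}=x_i-h/2$; $y_i^j$ is the value of the grid function $y$ at $(x_i,t_j)$. Set $$\mathbb{P}^{(\theta)}_{(\omega)}(\Delta_{0t_{j+1}})y_i=\int_\alpha^\beta\sum_{r=1}^m\omega_r(x_i,\gamma)\,\Delta_{0t_{j+1}}^{\theta_r(x_i,\gamma)}y_i\,d\gamma,$$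 $$\Delta_{0t_{j+1}}^{\theta}y_i=\frac1{\Gamma(2-\theta)}\sum_{s=0}^{j}\big(t_{j-s+1}^{1-\theta}-t_{j-s}^{1-\theta}\big)\frac{y_i^{s+1}-y_i^s}{\tau}.$$ Also $\Lambda y=(ay_{\bar x})_x-dy$ with $v_{\bar x,i}=(v_i-v_{i-1})/h$, $v_{x,i}=(v_{i+1}-v_i)/h$, i.e. $\Lambda y_i^{j+1}=\frac1h\Big(a_{i+1}^{j+1}\frac{y_{i+1}^{j+1}-y_i^{j+1}}h-a_i^{j+1}\frac{y_i^{j+1}-y_{i-1}^{j+1}}h\Big)-d_i^{j+1}y_i^{j+1}$, where $a_i^{j+1}=k(x_{i-1/2},t_{j+1})$, $d_i^{j+1}=q(x_i,t_{j+1})$, $\varphi_i^{j+1}=f(x_i,t_{j+1})$. Inner products and norms (over the spatial index $i$): $(y,v)=\sum_{i=1}^{N-1}y_iv_ih$, $(y,v]=\sum_{i=1}^{N}y_iv_ih$, $\|y\|_0^2=(y,y)$, $\|y]|_0^2=(y,y]$. "Absolutely stable" means that the stability estimate displayed in the claim holds for all steps $h,\tau$ without any restriction on their relative size. *)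

theory Defs
  imports "HOL-Analysis.Analysis"
begin

text \<open>The class \<open>C\<^sup>m\<^sup>,\<^sup>n\<close> on \<open>X \<times> Y\<close>: the pure partial derivatives up to order \<open>m\<close> in the first
  and up to order \<open>n\<close> in the second variable exist and are jointly continuous. Derivatives are taken
  within \<open>X\<close> and \<open>Y\<close>, hence one-sided at the end points of closed intervals.\<close>

definition C_class :: "nat \<Rightarrow> nat \<Rightarrow> real set \<Rightarrow> real set \<Rightarrow> (real \<Rightarrow> real \<Rightarrow> real) \<Rightarrow> bool" where
  "C_class m n X Y u \<longleftrightarrow>
     (\<exists>Dx Dt :: nat \<Rightarrow> real \<Rightarrow> real \<Rightarrow> real.
        Dx 0 = u \<and> Dt 0 = u \<and>
        (\<forall>p\<le>m. continuous_on (X \<times> Y) (\<lambda>(x, t). Dx p x t)) \<and>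
        (\<forall>p\<le>n. continuous_on (X \<times> Y) (\<lambda>(x, t). Dt p x t)) \<and>
        (\<forall>p<m. \<forall>x\<in>X. \<forall>t\<in>Y. ((\<lambda>\<xi>. Dx p \<xi> t) has_real_derivative Dx (Suc p) x t) (at x within X)) \<and>
        (\<forall>p<n. \<forall>x\<in>X. \<forall>t\<in>Y. ((\<lambda>\<eta>. Dt p x \<eta>) has_real_derivative Dt (Suc p) x t) (at t within Y)))"

text \<open>The value of \<open>deriv v\<close> at the end points (where \<open>v\<close> need only be differentiable from one side)
  does not influence the integral.\<close>

definition caputo :: "real \<Rightarrow> (real \<Rightarrow> real) \<Rightarrow> real \<Rightarrow> real" where
  "caputo \<theta> v t = 1 / Gamma (1 - \<theta>) * integral {0..t} (\<lambda>\<eta>. deriv v \<eta> * (t - \<eta>) powr (- \<theta>))"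

text \<open>The boundary value problem. The term \<open>(k u\<^sub>x)\<^sub>x\<close> is expressed by \<open>has_real_derivative\<close>, so that
  its existence is part of the equation.\<close>

definition solves_problem ::
  "real \<Rightarrow> real \<Rightarrow> real \<Rightarrow> real \<Rightarrow> nat \<Rightarrow> (nat \<Rightarrow> real \<Rightarrow> real \<Rightarrow> real) \<Rightarrow> (nat \<Rightarrow> real \<Rightarrow> real \<Rightarrow> real) \<Rightarrow>
   (real \<Rightarrow> real \<Rightarrow> real) \<Rightarrow> (real \<Rightarrow> real \<Rightarrow> real) \<Rightarrow> (real \<Rightarrow> real \<Rightarrow> real) \<Rightarrow> (real \<Rightarrow> real) \<Rightarrow>
   (real \<Rightarrow> real \<Rightarrow> real) \<Rightarrow> bool" where
  "solves_problem l T \<alpha> \<beta> m \<theta> \<omega> k q f u0 u \<longleftrightarrow>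
     (\<forall>x t. 0 < x \<and> x < l \<and> 0 < t \<and> t \<le> T \<longrightarrow>
        ((\<lambda>\<xi>. k \<xi> t * deriv (\<lambda>z. u z t) \<xi>) has_real_derivative
           integral {\<alpha>..\<beta>} (\<lambda>\<gamma>. \<Sum>r=1..m. \<omega> r x \<gamma> * caputo (\<theta> r x \<gamma>) (u x) t)
             + q x t * u x t - f x t) (at x)) \<and>
     (\<forall>t\<in>{0..T}. u 0 t = 0 \<and> u l t = 0) \<and>
     (\<forall>x\<in>{0..l}. u x 0 = u0 x)"

definition discrete_caputo :: "real \<Rightarrow> real \<Rightarrow> nat \<Rightarrow> (nat \<Rightarrow> real) \<Rightarrow> real" where
  "discrete_caputo \<tau> \<theta> j v =
     1 / Gamma (2 - \<theta>) *
     (\<Sum>s=0..j. ((real (j - s + 1) * \<tau>) powr (1 - \<theta>) - (real (j - s) * \<tau>) powr (1 - \<theta>))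
                * ((v (s + 1) - v s) / \<tau>))"

text \<open>A grid function \<open>y\<close> is indexed as \<open>y i j\<close>, with value at \<open>(x\<^sub>i, t\<^sub>j) = (i h, j \<tau>)\<close>.\<close>

definition discrete_P ::
  "real \<Rightarrow> real \<Rightarrow> nat \<Rightarrow> (nat \<Rightarrow> real \<Rightarrow> real \<Rightarrow> real) \<Rightarrow> (nat \<Rightarrow> real \<Rightarrow> real \<Rightarrow> real) \<Rightarrow>
   real \<Rightarrow> real \<Rightarrow> (nat \<Rightarrow> nat \<Rightarrow> real) \<Rightarrow> nat \<Rightarrow> nat \<Rightarrow> real" where
  "discrete_P \<alpha> \<beta> m \<theta> \<omega> h \<tau> y i j =
     integral {\<alpha>..\<beta>} (\<lambda>\<gamma>. \<Sum>r=1..m. \<omega> r (real i * h) \<gamma> *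
        discrete_caputo \<tau> (\<theta> r (real i * h) \<gamma>) j (y i))"

definition diff_bwd :: "real \<Rightarrow> (nat \<Rightarrow> real) \<Rightarrow> nat \<Rightarrow> real" where
  "diff_bwd h v i = (v i - v (i - 1)) / h"

definition diff_fwd :: "real \<Rightarrow> (nat \<Rightarrow> real) \<Rightarrow> nat \<Rightarrow> real" where
  "diff_fwd h v i = (v (i + 1) - v i) / h"

definition discrete_Lambda ::
  "(real \<Rightarrow> real \<Rightarrow> real) \<Rightarrow> (real \<Rightarrow> real \<Rightarrow> real) \<Rightarrow> real \<Rightarrow> real \<Rightarrow> (nat \<Rightarrow> nat \<Rightarrow> real) \<Rightarrow>
   nat \<Rightarrow> nat \<Rightarrow> real" where
  "discrete_Lambda k q h \<tau> y i j =
     diff_fwd h (\<lambda>i'. k (real i' * h - h / 2) (real j * \<tau>) * diff_bwd h (\<lambda>i''. y i'' j) i') i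
     - q (real i * h) (real j * \<tau>) * y i j"

definition solves_scheme ::
  "real \<Rightarrow> real \<Rightarrow> nat \<Rightarrow> (nat \<Rightarrow> real \<Rightarrow> real \<Rightarrow> real) \<Rightarrow> (nat \<Rightarrow> real \<Rightarrow> real \<Rightarrow> real) \<Rightarrow>
   (real \<Rightarrow> real \<Rightarrow> real) \<Rightarrow> (real \<Rightarrow> real \<Rightarrow> real) \<Rightarrow> (real \<Rightarrow> real \<Rightarrow> real) \<Rightarrow> (real \<Rightarrow> real) \<Rightarrow>
   nat \<Rightarrow> nat \<Rightarrow> real \<Rightarrow> real \<Rightarrow> (nat \<Rightarrow> nat \<Rightarrow> real) \<Rightarrow> bool" where
  "solves_scheme \<alpha> \<beta> m \<theta> \<omega> k q f u0 N j0 h \<tau> y \<longleftrightarrow>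
     (\<forall>i j. 1 \<le> i \<and> i \<le> N - 1 \<and> j < j0 \<longrightarrow>
        discrete_P \<alpha> \<beta> m \<theta> \<omega> h \<tau> y i j =
        discrete_Lambda k q h \<tau> y i (j + 1) + f (real i * h) (real (j + 1) * \<tau>)) \<and>
     (\<forall>j\<le>j0. y 0 j = 0 \<and> y N j = 0) \<and>
     (\<forall>i\<le>N. y i 0 = u0 (real i * h))"

text \<open>The inner products \<open>(u, v)\<close> and \<open>(u, v]\<close> with their squared norms.\<close>

definition ip :: "nat \<Rightarrow> real \<Rightarrow> (nat \<Rightarrow> real) \<Rightarrow> (nat \<Rightarrow> real) \<Rightarrow> real" where
  "ip N h u v = (\<Sum>i=1..N-1. u i * v i * h)"

definition ip_right :: "nat \<Rightarrow> real \<Rightarrow> (nat \<Rightarrow> real) \<Rightarrow> (nat \<Rightarrow> real) \<Rightarrow> real" where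
  "ip_right N h u v = (\<Sum>i=1..N. u i * v i * h)"

definition norm0_sq :: "nat \<Rightarrow> real \<Rightarrow> (nat \<Rightarrow> real) \<Rightarrow> real" where
  "norm0_sq N h u = ip N h u u"

definition norm0_right_sq :: "nat \<Rightarrow> real \<Rightarrow> (nat \<Rightarrow> real) \<Rightarrow> real" where
  "norm0_right_sq N h u = ip_right N h u u"

end

theory Submission
  imports Defs
begin

text \<open>Energy method. Testing the scheme with \<open>2 y\<^sub>i\<^sup>j\<^sup>+\<^sup>1\<close> and summing by parts in space, Alikhanov's
  inequality \<open>2 v\<^sup>j\<^sup>+\<^sup>1 \<Delta>\<^sup>\<theta> v \<ge> \<Delta>\<^sup>\<theta> (v\<^sup>2)\<close> (a consequence of the concavity of \<open>t \<mapsto> t\<^sup>1\<^sup>-\<^sup>\<theta>\<close>), Young's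
  inequality and the discrete Poincare inequality give an estimate on each time level. Summing over
  the time levels, the discrete Caputo derivatives of \<open>y\<^sup>2\<close> telescope exactly to the two weighted
  terms of the estimate.\<close>

section \<open>Concavity of powers and decay of the time weights\<close>

text \<open>The graph of \<open>u powr a\<close> lies below its tangent at the midpoint
  \<open>c\<close>: this is Young's inequality for \<open>u / c\<close> and 1 with exponents
  \<open>a\<close> and \<open>1 - a\<close>. The two tangent bounds add up to twice the value at
  \<open>c\<close>, because \<open>x\<close> and \<open>z\<close> average to
  \<open>c\<close>.\<close>

lemma powr_midpoint_concave:
  fixes x z a :: real
  assumes "0 \<le> x" "0 \<le> z" "0 \<le> a" "a \<le> 1"
  shows "x powr a + z powr a \<le> 2 * ((x + z) / 2) powr a"
proof (cases "x + z = 0")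
  case True
  then have "x = 0" "z = 0" using assms by linarith+
  then show ?thesis by simp
next
  case False
  define c where "c = (x + z) / 2"
  have c: "0 < c" using False assms by (simp add: c_def)
  have tangent: "u powr a \<le> (a * (u / c) + (1 - a)) * c powr a" if "0 \<le> u" for u
  proof -
    have "(u / c) powr a * 1 powr (1 - a) \<le> a * (u / c) + (1 - a) * 1"
    \<comment> \<open>Young's inequality asks for positive arguments. At \<open>u = 0\<close> the
      left side vanishes, since \<open>0 powr a = 0\<close> even for \<open>a = 0\<close>.\<close>
    proof (cases "u = 0")
      case False
      then show ?thesis
        using assms c that by (intro Youngs_inequality_0) auto
    qed (use assms in simp)
    then have "(u / c) powr a * c powr a \<le> (a * (u / c) + (1 - a)) * c powr a"
      by (intro mult_right_mono) auto
    moreover have "(u / c) powr a * c powr a = u powr a"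
      using c that by (simp add: powr_divide)
    ultimately show ?thesis by simp
  qed
  have "x powr a + z powr a \<le> (a * (x / c) + (1 - a)) * c powr a + (a * (z / c) + (1 - a)) * c powr a"
    using tangent assms by (intro add_mono) auto
  also have "\<dots> = (a * ((x + z) / c) + 2 * (1 - a)) * c powr a"
    by (simp add: algebra_simps add_divide_distrib)
  also have "(x + z) / c = 2" using c by (simp add: c_def field_simps)
  finally show ?thesis by (simp add: c_def algebra_simps)
qed

text \<open>For \<open>a = 1 - \<theta>\<close> these are, up to the factor
  \<open>1 / Gamma (2 - \<theta>)\<close> and the division by \<open>\<tau>\<close>, the
  coefficients of the L1 formula for the Caputo derivative. The index \<open>n\<close> counts steps
  back from the current level.\<close>

definition l1_weight :: "real \<Rightarrow> real \<Rightarrow> nat \<Rightarrow> real" where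
  "l1_weight \<tau> a n = (real (n + 1) * \<tau>) powr a - (real n * \<tau>) powr a"

lemma l1_weight_nonneg:
  assumes "0 \<le> \<tau>" "0 \<le> a"
  shows "0 \<le> l1_weight \<tau> a n"
  using assms by (auto simp: l1_weight_def intro!: powr_mono2 mult_right_mono)

text \<open>The difference of consecutive weights is a second difference of \<open>t powr a\<close>
  on an equidistant grid, so midpoint concavity fixes its sign.\<close>

lemma l1_weight_Suc_le:
  assumes "0 \<le> \<tau>" "0 \<le> a" "a \<le> 1"
  shows "l1_weight \<tau> a (Suc n) \<le> l1_weight \<tau> a n"
proof -
  have "(real (n + 2) * \<tau>) powr a + (real n * \<tau>) powr a
      \<le> 2 * ((real (n + 2) * \<tau> + real n * \<tau>) / 2) powr a"
    using assms by (intro powr_midpoint_concave) auto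
  also have "(real (n + 2) * \<tau> + real n * \<tau>) / 2 = real (n + 1) * \<tau>"
    by (simp add: algebra_simps)
  finally show ?thesis by (simp add: l1_weight_def)
qed

section \<open>Alikhanov's inequality for the discrete Caputo derivative\<close>

lemma discrete_caputo_l1_weight:
  "discrete_caputo \<tau> \<theta> j v =
     1 / Gamma (2 - \<theta>) * (\<Sum>s=0..j. l1_weight \<tau> (1 - \<theta>) (j - s) * ((v (s + 1) - v s) / \<tau>))"
  by (simp add: discrete_caputo_def l1_weight_def)

text \<open>Abel summation: each inner \<open>g s\<close> collects the factor
  \<open>c s - c (s - 1)\<close>, which is nonnegative, and the first term \<open>c 0 * g 0\<close>
  is nonnegative too. Only the last boundary term can be negative.\<close>

lemma sum_weighted_decrements_ge:
  fixes c g :: "nat \<Rightarrow> real"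
  assumes "\<And>s. s < n \<Longrightarrow> c s \<le> c (Suc s)" "0 \<le> c 0" "\<And>s. 0 \<le> g s"
  shows "(\<Sum>s=0..n. c s * (g s - g (s + 1))) \<ge> - c n * g (n + 1)"
  using assms(1)
proof (induction n)
  case 0
  then show ?case using assms(2,3) by (simp add: algebra_simps)
next
  case (Suc n)
  have "c n * g (n + 1) \<le> c (Suc n) * g (n + 1)"
    using Suc.prems assms(3) by (intro mult_right_mono) auto
  then show ?case using Suc by (simp add: algebra_simps)
qed

text \<open>Alikhanov's inequality. With \<open>w s = v (j + 1) - v s\<close> the difference of the two sides is,
  up to a positive factor, the weighted sum of the decrements of \<open>w\<^sup>2\<close>, and \<open>w (j + 1) = 0\<close>.\<close>

lemma discrete_caputo_square_le:
  assumes "0 < \<tau>" "0 < \<theta>" "\<theta> < 1"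
  shows "discrete_caputo \<tau> \<theta> j (\<lambda>s. (v s)\<^sup>2) \<le> 2 * v (j + 1) * discrete_caputo \<tau> \<theta> j v"
proof -
  define b where "b s = l1_weight \<tau> (1 - \<theta>) (j - s)" for s
  define w where "w s = v (j + 1) - v s" for s
  \<comment> \<open>The index \<open>j - s\<close> reverses the order, so weights that decay into
    the past grow with \<open>s\<close>.\<close>
  have mono: "b s \<le> b (Suc s)" if "s < j" for s
    using l1_weight_Suc_le[of \<tau> "1 - \<theta>" "j - Suc s"] assms that
    by (simp add: b_def Suc_diff_Suc)
  have "(\<Sum>s=0..j. b s * ((w s)\<^sup>2 - (w (s + 1))\<^sup>2)) \<ge> - b j * (w (j + 1))\<^sup>2"
    by (rule sum_weighted_decrements_ge) (use mono l1_weight_nonneg assms in \<open>auto simp: b_def\<close>)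
  then have nonneg: "(\<Sum>s=0..j. b s * ((w s)\<^sup>2 - (w (s + 1))\<^sup>2)) \<ge> 0"
    by (simp add: w_def)
  have w2: "(w s)\<^sup>2 - (w (s + 1))\<^sup>2 = 2 * v (j + 1) * (v (s + 1) - v s) - ((v (s + 1))\<^sup>2 - (v s)\<^sup>2)" for s
    by (simp add: w_def power2_eq_square algebra_simps)
  have "2 * v (j + 1) * discrete_caputo \<tau> \<theta> j v - discrete_caputo \<tau> \<theta> j (\<lambda>s. (v s)\<^sup>2)
      = 1 / (Gamma (2 - \<theta>) * \<tau>) * (\<Sum>s=0..j. b s * ((w s)\<^sup>2 - (w (s + 1))\<^sup>2))"
    unfolding discrete_caputo_l1_weight b_def[symmetric] w2 sum_distrib_left
      sum_subtractf[symmetric]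
    by (intro sum.cong refl) (simp add: algebra_simps diff_divide_distrib add_divide_distrib)
  also have "\<dots> \<ge> 0"
    using nonneg assms by (intro mult_nonneg_nonneg) (auto intro!: Gamma_real_nonneg)
  finally show ?thesis by simp
qed

section \<open>Telescoping of the discrete Caputo derivative in time\<close>

text \<open>Discrete counterpart of integrating the convolution of \<open>p'\<close> and
  \<open>v'\<close> over time, which gives the convolution of \<open>p'\<close> and \<open>v\<close>
  minus \<open>p\<close> times the initial value of \<open>v\<close>.\<close>

lemma sum_convolution_differences:
  fixes p v :: "nat \<Rightarrow> real"
  assumes "p 0 = 0"
  shows "(\<Sum>n=0..j. \<Sum>s=0..n. (p (n - s + 1) - p (n - s)) * (v (s + 1) - v s))
       = (\<Sum>s=0..j. (p (j - s + 1) - p (j - s)) * v (s + 1)) - p (j + 1) * v 0"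
proof (induction j)
  case 0
  then show ?case using assms by (simp add: algebra_simps)
next
  case (Suc j)
  define D where "D n = p (n + 1) - p n" for n
  \<comment> \<open>After the shift, the \<open>v s\<close> half of the new row cancels the whole
    sum of the induction hypothesis. The leftover \<open>D (Suc j) * v 0\<close> raises the index of
    \<open>p\<close> in the initial term by one.\<close>
  have shift: "(\<Sum>s=0..Suc j. D (Suc j - s) * v s)
      = D (Suc j) * v 0 + (\<Sum>s=0..j. D (j - s) * v (s + 1))"
    by (subst sum.atLeast0_atMost_Suc_shift) simp
  have "(\<Sum>n=0..Suc j. \<Sum>s=0..n. D (n - s) * (v (s + 1) - v s))
      = (\<Sum>s=0..j. D (j - s) * v (s + 1)) - p (j + 1) * v 0
        + ((\<Sum>s=0..Suc j. D (Suc j - s) * v (s + 1)) - (\<Sum>s=0..Suc j. D (Suc j - s) * v s))"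
  proof -
    have "(\<Sum>n=0..j. \<Sum>s=0..n. D (n - s) * (v (s + 1) - v s))
        = (\<Sum>s=0..j. D (j - s) * v (s + 1)) - p (j + 1) * v 0"
      unfolding D_def by (rule Suc.IH)
    moreover have "(\<Sum>s=0..Suc j. D (Suc j - s) * (v (s + 1) - v s))
        = (\<Sum>s=0..Suc j. D (Suc j - s) * v (s + 1)) - (\<Sum>s=0..Suc j. D (Suc j - s) * v s)"
      unfolding right_diff_distrib by (rule sum_subtractf)
    ultimately show ?thesis
      by (subst sum.atLeast0_atMost_Suc) simp
  qed
  also have "\<dots> = (\<Sum>s=0..Suc j. D (Suc j - s) * v (s + 1)) - p (Suc j + 1) * v 0"
    unfolding shift by (simp add: D_def algebra_simps)
  finally show ?case by (simp only: D_def)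
qed

text \<open>The sequence \<open>p\<close> is the power \<open>1 - \<theta>\<close> of the grid
  times, with \<open>p 0 = 0\<close>, and the factor \<open>\<tau>\<close> cancels the step of the
  difference quotient. Applied to squares, this yields the history term and the initial term of the
  stability estimate.\<close>

lemma sum_discrete_caputo:
  assumes "0 < \<tau>" "\<theta> < 1"
  shows "(\<Sum>n=0..j. \<tau> * discrete_caputo \<tau> \<theta> n v) =
    1 / Gamma (2 - \<theta>) *
      ((\<Sum>s=0..j. ((real (j - s + 1) * \<tau>) powr (1 - \<theta>) - (real (j - s) * \<tau>) powr (1 - \<theta>)) * v (s + 1))
       - (real (j + 1) * \<tau>) powr (1 - \<theta>) * v 0)"
proof -
  have "(\<Sum>n=0..j. \<tau> * discrete_caputo \<tau> \<theta> n v)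
      = 1 / Gamma (2 - \<theta>) * (\<Sum>n=0..j. \<Sum>s=0..n.
          ((real (n - s + 1) * \<tau>) powr (1 - \<theta>) - (real (n - s) * \<tau>) powr (1 - \<theta>)) * (v (s + 1) - v s))"
    unfolding discrete_caputo_def sum_distrib_left using assms
    by (intro sum.cong refl) simp
  then show ?thesis
    using sum_convolution_differences[of "\<lambda>n. (real n * \<tau>) powr (1 - \<theta>)" v j] by simp
qed

section \<open>Discrete Poincare inequality and the energy estimate in space\<close>

text \<open>Each \<open>v i\<close> telescopes from the left end, and Cauchy-Schwarz bounds its
  square by \<open>i\<close> times the sum of all squared increments. Summing over \<open>i\<close>
  brings in the triangular numbers, hence the factor 1/2.\<close>

lemma norm0_sq_le_norm0_right_sq_diff_bwd:
  assumes h: "0 < h" and "v 0 = 0"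
  shows "norm0_sq N h v \<le> (h * real N)\<^sup>2 / 2 * norm0_right_sq N h (diff_bwd h v)"
proof -
  define S where "S = (\<Sum>p=1..N. (v p - v (p - 1))\<^sup>2)"
  have S: "S = h * norm0_right_sq N h (diff_bwd h v)"
    using h by (simp add: S_def norm0_right_sq_def ip_right_def diff_bwd_def sum_distrib_left
        power2_eq_square)
  have S0: "0 \<le> S" by (simp add: S_def sum_nonneg)
  have telescope: "v i = (\<Sum>p=1..i. v p - v (p - 1))" for i
    using \<open>v 0 = 0\<close> by (induction i) auto
  have bound: "(v i)\<^sup>2 \<le> real i * S" if "i \<le> N" for i
  proof -
    have "(v i)\<^sup>2 = (\<Sum>p=1..i. v p - v (p - 1))\<^sup>2" by (subst telescope) simp
    also have "\<dots> \<le> (\<Sum>p=1..i. (v p - v (p - 1))\<^sup>2) * real (card {1..i})"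
      by (rule sum_squared_le_sum_of_squares)
    also have "\<dots> \<le> S * real i"
      unfolding S_def using that by (auto intro!: mult_right_mono sum_mono2)
    finally show ?thesis by (simp add: mult.commute)
  qed
  have gauss: "(\<Sum>i=1..n - 1. real i) \<le> (real n)\<^sup>2 / 2" for n
  proof (induction n)
    case (Suc n)
    then show ?case by (cases n) (auto simp: power2_eq_square field_simps)
  qed simp
  have "norm0_sq N h v = (\<Sum>i=1..N-1. (v i)\<^sup>2 * h)"
    by (simp add: norm0_sq_def ip_def power2_eq_square)
  also have "\<dots> \<le> (\<Sum>i=1..N-1. real i * S * h)"
    using h by (intro sum_mono mult_right_mono bound) auto
  also have "\<dots> = (\<Sum>i=1..N-1. real i) * (S * h)"
    by (simp add: sum_distrib_right mult.assoc)
  also have "\<dots> \<le> (real N)\<^sup>2 / 2 * (S * h)"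
    using S0 h by (intro mult_right_mono gauss) auto
  finally show ?thesis by (simp add: S power2_eq_square mult_ac)
qed

lemma sum_by_parts_nat:
  fixes v g :: "nat \<Rightarrow> real"
  shows "(\<Sum>i=1..n. v i * (g (i + 1) - g i)) + (\<Sum>i=1..n. g i * (v i - v (i - 1)))
       = v n * g (n + 1) - v 0 * g 1"
  by (induction n) (auto simp: algebra_simps)

text \<open>Testing with \<open>2 * v\<close> and summing by parts produces twice the energy, of
  which one half stays on the left and the other absorbs the part of the source term containing
  \<open>v\<close>. The function \<open>P\<close> is left abstract, so the time derivative enters
  only through the equation.\<close>

lemma elliptic_energy_estimate:
  assumes h: "0 < h" and N: "0 < N" and c: "0 < c"
    and v: "v 0 = 0" "v N = 0"
    and a: "\<And>i. i \<in> {1..N} \<Longrightarrow> c \<le> a i"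
    and d: "\<And>i. i \<in> {1..N-1} \<Longrightarrow> 0 \<le> d i"
    and eq: "\<And>i. i \<in> {1..N-1} \<Longrightarrow> P i = diff_fwd h (\<lambda>i. a i * diff_bwd h v i) i - d i * v i + \<phi> i"
  shows "2 * ip N h v P + c * norm0_right_sq N h (diff_bwd h v)
       \<le> (h * real N)\<^sup>2 / (2 * c) * norm0_sq N h \<phi>"
proof -
  define L where "L = h * real N"
  have L: "0 < L" using h N by (simp add: L_def)
  define g where "g i = a i * diff_bwd h v i" for i
  define E where "E = norm0_right_sq N h (diff_bwd h v)"
  \<comment> \<open>The term at \<open>N\<close> vanishes together with \<open>v N\<close>, so the
    sum can be extended to the range of the right-closed norm.\<close>
  have "{1..N} = insert N {1..N-1}" using N by auto
  then have "(\<Sum>i=1..N-1. v i * (g (i + 1) - g i)) = (\<Sum>i=1..N. v i * (g (i + 1) - g i))"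
    using v N by simp
  also have "\<dots> = - (\<Sum>i=1..N. g i * (v i - v (i - 1)))"
    using sum_by_parts_nat[of v g N] v by simp
  also have "\<dots> = - (\<Sum>i=1..N. a i * (diff_bwd h v i * diff_bwd h v i * h))"
    using h by (simp add: g_def diff_bwd_def mult.assoc)
  also have "\<dots> \<le> - (\<Sum>i=1..N. c * (diff_bwd h v i * diff_bwd h v i * h))"
    using a h by (intro le_imp_neg_le sum_mono mult_right_mono) auto
  finally have parts: "(\<Sum>i=1..N-1. v i * (g (i + 1) - g i)) \<le> - (c * E)"
    by (simp add: E_def norm0_right_sq_def ip_right_def sum_distrib_left)
  have "2 * ip N h v P
      = (\<Sum>i=1..N-1. 2 * (v i * (g (i + 1) - g i)) - 2 * d i * (v i)\<^sup>2 * h + 2 * v i * \<phi> i * h)"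
    unfolding ip_def sum_distrib_left
  proof (rule sum.cong)
    fix i assume i: "i \<in> {1..N-1}"
    have "h * P i = g (i + 1) - g i - h * (d i * v i) + h * \<phi> i"
    proof -
      have "h * diff_fwd h g i = g (i + 1) - g i" using h by (simp add: diff_fwd_def)
      then show ?thesis
        using eq[OF i] unfolding g_def[symmetric] by (simp add: right_diff_distrib distrib_left)
    qed
    then have "2 * v i * (h * P i) = 2 * v i * (g (i + 1) - g i - h * (d i * v i) + h * \<phi> i)"
      by simp
    then show "2 * (v i * P i * h)
        = 2 * (v i * (g (i + 1) - g i)) - 2 * d i * (v i)\<^sup>2 * h + 2 * v i * \<phi> i * h"
      by (simp add: algebra_simps power2_eq_square)
  qed simp
  also have "\<dots> \<le> (\<Sum>i=1..N-1. 2 * (v i * (g (i + 1) - g i))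
        + (2 * c / L\<^sup>2 * (v i * v i * h) + L\<^sup>2 / (2 * c) * (\<phi> i * \<phi> i * h)))"
  proof (rule sum_mono)
    fix i assume i: "i \<in> {1..N-1}"
    \<comment> \<open>The weight \<open>2 * c / L\<^sup>2\<close> is the reciprocal of the Poincare
      constant \<open>L\<^sup>2 / 2\<close> times \<open>c\<close>, so that the \<open>v\<close>
      part costs exactly one copy of \<open>c * E\<close>.\<close>
    have "2 * v i * \<phi> i \<le> 2 * c / L\<^sup>2 * (v i)\<^sup>2 + L\<^sup>2 / (2 * c) * (\<phi> i)\<^sup>2"
    proof -
      have "0 \<le> (2 * c * v i - L\<^sup>2 * \<phi> i)\<^sup>2 / (2 * c * L\<^sup>2)"
        using c by simp
      also have "\<dots> = 2 * c / L\<^sup>2 * (v i)\<^sup>2 + L\<^sup>2 / (2 * c) * (\<phi> i)\<^sup>2 - 2 * v i * \<phi> i"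
        using c L by (simp add: field_simps power2_eq_square)
      finally show ?thesis by simp
    qed
    then have "2 * v i * \<phi> i * h \<le> (2 * c / L\<^sup>2 * (v i)\<^sup>2 + L\<^sup>2 / (2 * c) * (\<phi> i)\<^sup>2) * h"
      using h by (intro mult_right_mono) auto
    moreover have "0 \<le> 2 * d i * (v i)\<^sup>2 * h" using d[OF i] h by simp
    ultimately show "2 * (v i * (g (i + 1) - g i)) - 2 * d i * (v i)\<^sup>2 * h + 2 * v i * \<phi> i * h
        \<le> 2 * (v i * (g (i + 1) - g i))
          + (2 * c / L\<^sup>2 * (v i * v i * h) + L\<^sup>2 / (2 * c) * (\<phi> i * \<phi> i * h))"
      by (simp add: algebra_simps power2_eq_square)
  qed
  also have "\<dots> = 2 * (\<Sum>i=1..N-1. v i * (g (i + 1) - g i))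
      + (2 * c / L\<^sup>2 * norm0_sq N h v + L\<^sup>2 / (2 * c) * norm0_sq N h \<phi>)"
    by (simp add: sum.distrib sum_distrib_left norm0_sq_def ip_def)
  also have "\<dots> \<le> 2 * (- (c * E)) + (2 * c / L\<^sup>2 * (L\<^sup>2 / 2 * E) + L\<^sup>2 / (2 * c) * norm0_sq N h \<phi>)"
    using parts norm0_sq_le_norm0_right_sq_diff_bwd[of h v N] h v c
    by (intro add_mono mult_left_mono) (auto simp: E_def L_def)
  also have "\<dots> = - (c * E) + L\<^sup>2 / (2 * c) * norm0_sq N h \<phi>"
    using L by simp
  finally show ?thesis by (simp add: E_def L_def)
qed

section \<open>Integrals over the distributed order\<close>

text \<open>A continuous factor on a compact interval is bounded and measurable, and such factors
  preserve Lebesgue integrability. A merely Henstock-Kurzweil integrable \<open>w\<close> could lose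
  integrability under a continuous factor.\<close>

lemma integrable_mult_continuous_on:
  fixes w g :: "real \<Rightarrow> real"
  assumes "w absolutely_integrable_on {a..b}" "continuous_on {a..b} g"
  shows "(\<lambda>x. w x * g x) integrable_on {a..b}"
proof -
  have "(\<lambda>x. g x * w x) absolutely_integrable_on {a..b}"
  proof (rule absolutely_integrable_bounded_measurable_product_real)
    show "g \<in> borel_measurable (lebesgue_on {a..b})"
      by (rule continuous_imp_measurable_on_sets_lebesgue) (use assms in auto)
    show "bounded (g ` {a..b})"
      using assms(2) by (intro compact_imp_bounded compact_continuous_image) auto
  qed (use assms in auto)
  then show ?thesis
    by (simp add: absolutely_integrable_on_def mult.commute)
qed

lemma continuous_on_Gamma_two_minus:
  fixes \<theta> :: "real \<Rightarrow> real"
  assumes "continuous_on A \<theta>" "\<And>x. x \<in> A \<Longrightarrow> \<theta> x < 1"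
  shows "continuous_on A (\<lambda>x. Gamma (2 - \<theta> x))"
proof -
  have pos: "0 < 2 - \<theta> x" if "x \<in> A" for x using assms(2)[OF that] by simp
  have "continuous_on {0<..} (Gamma :: real \<Rightarrow> real)"
    by (rule continuous_on_Gamma) (auto elim!: nonpos_Ints_cases)
  then show ?thesis
    by (rule continuous_on_compose2) (use assms pos in \<open>auto intro!: continuous_intros\<close>)
qed

lemma Gamma_two_minus_pos:
  fixes \<theta> :: real
  shows "\<theta> < 1 \<Longrightarrow> 0 < Gamma (2 - \<theta>)"
  by (intro Gamma_real_pos) simp

text \<open>The base 0 does occur, as the initial grid time; there the strictly positive exponent
  keeps the power continuous.\<close>

lemma continuous_on_powr_one_minus:
  fixes \<theta> :: "real \<Rightarrow> real"
  assumes "continuous_on A \<theta>" "\<And>x. x \<in> A \<Longrightarrow> \<theta> x < 1" "0 \<le> c"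
  shows "continuous_on A (\<lambda>x. c powr (1 - \<theta> x))"
  using assms by (intro continuous_on_powr') (auto intro!: continuous_intros)

lemma integrable_mult_discrete_caputo:
  fixes w \<theta> :: "real \<Rightarrow> real"
  assumes w: "w absolutely_integrable_on {\<alpha>..\<beta>}"
    and \<theta>: "continuous_on {\<alpha>..\<beta>} \<theta>" "\<And>\<gamma>. \<gamma> \<in> {\<alpha>..\<beta>} \<Longrightarrow> \<theta> \<gamma> < 1"
    and \<tau>: "0 < \<tau>"
  shows "(\<lambda>\<gamma>. w \<gamma> * discrete_caputo \<tau> (\<theta> \<gamma>) j v) integrable_on {\<alpha>..\<beta>}"
proof (rule integrable_mult_continuous_on[OF w])
  have "Gamma (2 - \<theta> \<gamma>) \<noteq> 0" if "\<gamma> \<in> {\<alpha>..\<beta>}" for \<gamma>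
    using Gamma_two_minus_pos[OF \<theta>(2)[OF that]] by simp
  then show "continuous_on {\<alpha>..\<beta>} (\<lambda>\<gamma>. discrete_caputo \<tau> (\<theta> \<gamma>) j v)"
    unfolding discrete_caputo_def using \<theta> \<tau>
    by (intro continuous_intros continuous_on_Gamma_two_minus continuous_on_powr_one_minus) auto
qed

text \<open>Alikhanov's inequality holds for every single order, and the nonnegative weights
  preserve it under summation and integration. The factor \<open>2 * y i (j + 1)\<close> does not
  depend on \<open>\<gamma>\<close> and leaves the integral.\<close>

lemma discrete_P_square_le:
  assumes \<tau>: "0 < \<tau>"
    and \<theta>: "\<And>r. r \<in> {1..m} \<Longrightarrow> continuous_on {\<alpha>..\<beta>} (\<theta> r (real i * h))"
      "\<And>r \<gamma>. r \<in> {1..m} \<Longrightarrow> \<gamma> \<in> {\<alpha>..\<beta>} \<Longrightarrow> 0 < \<theta> r (real i * h) \<gamma> \<and> \<theta> r (real i * h) \<gamma> < 1"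
    and \<omega>: "\<And>r \<gamma>. r \<in> {1..m} \<Longrightarrow> \<gamma> \<in> {\<alpha>..\<beta>} \<Longrightarrow> 0 \<le> \<omega> r (real i * h) \<gamma>"
      "\<And>r. r \<in> {1..m} \<Longrightarrow> \<omega> r (real i * h) absolutely_integrable_on {\<alpha>..\<beta>}"
  shows "discrete_P \<alpha> \<beta> m \<theta> \<omega> h \<tau> (\<lambda>i j. (y i j)\<^sup>2) i j
       \<le> 2 * y i (j + 1) * discrete_P \<alpha> \<beta> m \<theta> \<omega> h \<tau> y i j"
proof -
  let ?C = "\<lambda>r \<gamma> v. discrete_caputo \<tau> (\<theta> r (real i * h) \<gamma>) j v"
  have int: "(\<lambda>\<gamma>. \<Sum>r=1..m. \<omega> r (real i * h) \<gamma> * ?C r \<gamma> v) integrable_on {\<alpha>..\<beta>}" for v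
    using assms by (intro integrable_sum integrable_mult_discrete_caputo) auto
  have "discrete_P \<alpha> \<beta> m \<theta> \<omega> h \<tau> (\<lambda>i j. (y i j)\<^sup>2) i j
      \<le> integral {\<alpha>..\<beta>} (\<lambda>\<gamma>. 2 * y i (j + 1) * (\<Sum>r=1..m. \<omega> r (real i * h) \<gamma> * ?C r \<gamma> (y i)))"
    unfolding discrete_P_def
  proof (rule integral_le)
    fix \<gamma> assume \<gamma>: "\<gamma> \<in> {\<alpha>..\<beta>}"
    have "(\<Sum>r=1..m. \<omega> r (real i * h) \<gamma> * ?C r \<gamma> (\<lambda>j. (y i j)\<^sup>2))
        \<le> (\<Sum>r=1..m. \<omega> r (real i * h) \<gamma> * (2 * y i (j + 1) * ?C r \<gamma> (y i)))"
      using \<omega> \<theta> \<tau> \<gamma> by (intro sum_mono mult_left_mono discrete_caputo_square_le) auto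
    then show "(\<Sum>r=1..m. \<omega> r (real i * h) \<gamma> * ?C r \<gamma> (\<lambda>j. (y i j)\<^sup>2))
        \<le> 2 * y i (j + 1) * (\<Sum>r=1..m. \<omega> r (real i * h) \<gamma> * ?C r \<gamma> (y i))"
      by (simp add: sum_distrib_left mult_ac)
  qed (intro int integrable_on_mult_right)+
  then show ?thesis by (simp add: discrete_P_def)
qed

section \<open>A priori estimate for the difference scheme\<close>

theorem theorem3:
  fixes l T \<alpha> \<beta> c1 c2 :: real
    and m :: nat
    and \<theta> \<omega> :: "nat \<Rightarrow> real \<Rightarrow> real \<Rightarrow> real"
    and k q f :: "real \<Rightarrow> real \<Rightarrow> real"
    and u0 :: "real \<Rightarrow> real"
  assumes "0 < l" and "0 < T" and "\<alpha> < \<beta>" and "1 \<le> m"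
    and "\<And>r. r \<in> {1..m} \<Longrightarrow> continuous_on ({0..l} \<times> {\<alpha>..\<beta>}) (\<lambda>(x, \<gamma>). \<theta> r x \<gamma>)"
    and "\<And>r x \<gamma>. r \<in> {1..m} \<Longrightarrow> x \<in> {0..l} \<Longrightarrow> \<gamma> \<in> {\<alpha>..\<beta>} \<Longrightarrow> 0 < \<theta> r x \<gamma> \<and> \<theta> r x \<gamma> < 1"
    and "\<And>r x \<gamma>. r \<in> {1..m} \<Longrightarrow> x \<in> {0..l} \<Longrightarrow> \<gamma> \<in> {\<alpha>..\<beta>} \<Longrightarrow> 0 \<le> \<omega> r x \<gamma>"
    and "\<And>r x. r \<in> {1..m} \<Longrightarrow> x \<in> {0..l} \<Longrightarrow> \<omega> r x absolutely_integrable_on {\<alpha>..\<beta>}"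
    and "\<And>x. x \<in> {0..l} \<Longrightarrow> 0 < integral {\<alpha>..\<beta>} (\<lambda>\<gamma>. \<Sum>r=1..m. \<omega> r x \<gamma>)"
    and "0 < c1"
    and "\<And>x t. x \<in> {0..l} \<Longrightarrow> t \<in> {0..T} \<Longrightarrow> c1 \<le> k x t \<and> k x t \<le> c2"
    and "\<And>x t. x \<in> {0..l} \<Longrightarrow> t \<in> {0..T} \<Longrightarrow> 0 \<le> q x t"
    and "continuous_on ({0..l} \<times> {0..T}) (\<lambda>(x, t). k x t)"
    and "continuous_on ({0..l} \<times> {0..T}) (\<lambda>(x, t). q x t)"
    and "continuous_on ({0..l} \<times> {0..T}) (\<lambda>(x, t). f x t)"
    and "continuous_on {0..l} u0"
    and "\<exists>u. C_class 4 3 {0..l} {0..T} u \<and> solves_problem l T \<alpha> \<beta> m \<theta> \<omega> k q f u0 u"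
  shows
    "\<forall>(N::nat) (j0::nat) (h::real) (\<tau>::real) (y :: nat \<Rightarrow> nat \<Rightarrow> real).
       0 < N \<and> 0 < j0 \<and> h * real N = l \<and> \<tau> * real j0 = T \<and>
       solves_scheme \<alpha> \<beta> m \<theta> \<omega> k q f u0 N j0 h \<tau> y \<longrightarrow>
       (\<forall>j<j0.
          integral {\<alpha>..\<beta>} (\<lambda>\<gamma>. \<Sum>r=1..m.
            ip N h
              (\<lambda>i. \<omega> r (real i * h) \<gamma> / Gamma (2 - \<theta> r (real i * h) \<gamma>))
              (\<lambda>i. \<Sum>s=0..j.
                 ((real (j - s + 1) * \<tau>) powr (1 - \<theta> r (real i * h) \<gamma>)
                   - (real (j - s) * \<tau>) powr (1 - \<theta> r (real i * h) \<gamma>)) * (y i (s + 1))\<^sup>2))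
          + c1 * (\<Sum>s=0..j. norm0_right_sq N h (diff_bwd h (\<lambda>i. y i (s + 1))) * \<tau>)
          \<le> l\<^sup>2 / (2 * c1) *
              (\<Sum>s=0..j. norm0_sq N h (\<lambda>i. f (real i * h) (real (s + 1) * \<tau>)) * \<tau>)
            + integral {\<alpha>..\<beta>} (\<lambda>\<gamma>. \<Sum>r=1..m.
                ip N h
                  (\<lambda>i. \<omega> r (real i * h) \<gamma> * (real (j + 1) * \<tau>) powr (1 - \<theta> r (real i * h) \<gamma>)
                        / Gamma (2 - \<theta> r (real i * h) \<gamma>))
                  (\<lambda>i. (u0 (real i * h))\<^sup>2)))"
proof (intro allI impI, elim conjE)
  fix N j0 :: nat and h \<tau> :: real and y :: "nat \<Rightarrow> nat \<Rightarrow> real" and j :: nat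
  assume N: "0 < N" and "0 < j0" and hN: "h * real N = l" and \<tau>j0: "\<tau> * real j0 = T"
    and scheme: "solves_scheme \<alpha> \<beta> m \<theta> \<omega> k q f u0 N j0 h \<tau> y" and j: "j < j0"
  have h: "0 < h"
    using \<open>0 < l\<close> N hN by (metis of_nat_0_le_iff zero_less_mult_pos2 of_nat_0_less_iff)
  have \<tau>: "0 < \<tau>"
    using \<open>0 < T\<close> \<open>0 < j0\<close> \<tau>j0 by (metis zero_less_mult_pos2 of_nat_0_less_iff)
  have x_mem: "real i * h \<in> {0..l}" if "i \<le> N" for i
    using that h hN by (auto simp: mult.commute intro!: mult_left_mono)
  have x_half_mem: "real i * h - h / 2 \<in> {0..l}" if "i \<in> {1..N}" for i
  proof -
    have "1 * h \<le> real i * h" using that h by (intro mult_right_mono) auto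
    then show ?thesis using x_mem[of i] that h by auto
  qed
  have t_mem: "real n * \<tau> \<in> {0..T}" if "n \<le> j0" for n
    using that \<tau> \<tau>j0 by (auto simp: mult.commute intro!: mult_left_mono)
  have y_bd: "y 0 n = 0" "y N n = 0" if "n \<le> j0" for n
    using scheme that by (auto simp: solves_scheme_def)
  have y_0: "y i 0 = u0 (real i * h)" if "i \<le> N" for i
    using scheme that by (auto simp: solves_scheme_def)
  have \<theta>_cont: "continuous_on {\<alpha>..\<beta>} (\<theta> r x)" if "r \<in> {1..m}" "x \<in> {0..l}" for r x
  proof -
    have "continuous_on {\<alpha>..\<beta>} (\<lambda>\<gamma>. (\<lambda>(x, \<gamma>). \<theta> r x \<gamma>) (x, \<gamma>))"
      by (rule continuous_on_compose2[OF assms(5)[OF that(1)]])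
        (use that(2) in \<open>auto intro!: continuous_intros\<close>)
    then show ?thesis by simp
  qed
  define P where "P n i = discrete_P \<alpha> \<beta> m \<theta> \<omega> h \<tau> y i n" for n i
  define P2 where "P2 n i = discrete_P \<alpha> \<beta> m \<theta> \<omega> h \<tau> (\<lambda>i j. (y i j)\<^sup>2) i n" for n i
  define E where "E n = norm0_right_sq N h (diff_bwd h (\<lambda>i. y i (n + 1)))" for n
  define F where "F n = norm0_sq N h (\<lambda>i. f (real i * h) (real (n + 1) * \<tau>))" for n

  \<comment> \<open>Energy estimate on level \<open>n + 1\<close>. Replacing the tested operator by
    its value on \<open>y\<^sup>2\<close> makes the left side linear in the squares, so that it can
    be summed exactly over time.\<close>
  have step: "(\<Sum>i=1..N-1. P2 n i * h) + c1 * E n \<le> l\<^sup>2 / (2 * c1) * F n" if n: "n < j0" for n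
  proof -
    have "(\<Sum>i=1..N-1. P2 n i * h) \<le> 2 * ip N h (\<lambda>i. y i (n + 1)) (P n)"
      unfolding ip_def sum_distrib_left
    proof (rule sum_mono)
      fix i assume "i \<in> {1..N-1}"
      then have x: "real i * h \<in> {0..l}" by (intro x_mem) auto
      have "P2 n i \<le> 2 * y i (n + 1) * P n i"
        unfolding P2_def P_def
        by (rule discrete_P_square_le[OF \<tau>]) (use x \<theta>_cont assms(6-8) in auto)
      then have "P2 n i * h \<le> 2 * y i (n + 1) * P n i * h"
        using h by (intro mult_right_mono) auto
      then show "P2 n i * h \<le> 2 * (y i (n + 1) * P n i * h)" by (simp add: mult_ac)
    qed
    moreover have "2 * ip N h (\<lambda>i. y i (n + 1)) (P n) + c1 * E n \<le> (h * real N)\<^sup>2 / (2 * c1) * F n"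
      unfolding E_def F_def
    proof (rule elliptic_energy_estimate[OF h N \<open>0 < c1\<close>])
      show "y 0 (n + 1) = 0" "y N (n + 1) = 0" using y_bd n by auto
      show "c1 \<le> k (real i * h - h / 2) (real (n + 1) * \<tau>)" if "i \<in> {1..N}" for i
        using assms(11)[OF x_half_mem[OF that] t_mem[of "n + 1"]] n by auto
      show "0 \<le> q (real i * h) (real (n + 1) * \<tau>)" if "i \<in> {1..N-1}" for i
        using that n by (intro assms(12) x_mem t_mem) auto
      show "P n i = diff_fwd h (\<lambda>i. k (real i * h - h / 2) (real (n + 1) * \<tau>)
              * diff_bwd h (\<lambda>i. y i (n + 1)) i) i
            - q (real i * h) (real (n + 1) * \<tau>) * y i (n + 1) + f (real i * h) (real (n + 1) * \<tau>)"
        if "i \<in> {1..N-1}" for i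
        using scheme n that by (auto simp: P_def solves_scheme_def discrete_Lambda_def)
    qed
    ultimately show ?thesis by (simp add: hN)
  qed

  have "(\<Sum>n=0..j. ((\<Sum>i=1..N-1. P2 n i * h) + c1 * E n) * \<tau>) \<le> (\<Sum>n=0..j. l\<^sup>2 / (2 * c1) * F n * \<tau>)"
    using step j \<tau> by (intro sum_mono mult_right_mono) auto
  then have main: "(\<Sum>n=0..j. \<Sum>i=1..N-1. P2 n i * h * \<tau>) + c1 * (\<Sum>n=0..j. E n * \<tau>)
      \<le> l\<^sup>2 / (2 * c1) * (\<Sum>n=0..j. F n * \<tau>)"
    by (simp add: distrib_right sum.distrib sum_distrib_left sum_distrib_right mult.assoc)

  \<comment> \<open>\<open>A\<close> and \<open>B\<close> are the contributions of order
    \<open>r\<close> and node \<open>i\<close> to the two weighted terms of the estimate.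
    \<open>C\<close> is the matching part of the integrand of \<open>P2 n i\<close>, still without
    \<open>h\<close> and \<open>\<tau>\<close>.\<close>
  define A where "A \<gamma> r i = \<omega> r (real i * h) \<gamma> / Gamma (2 - \<theta> r (real i * h) \<gamma>)
      * (\<Sum>s=0..j. ((real (j - s + 1) * \<tau>) powr (1 - \<theta> r (real i * h) \<gamma>)
           - (real (j - s) * \<tau>) powr (1 - \<theta> r (real i * h) \<gamma>)) * (y i (s + 1))\<^sup>2) * h" for \<gamma> r i
  define B where "B \<gamma> r i = \<omega> r (real i * h) \<gamma> * (real (j + 1) * \<tau>) powr (1 - \<theta> r (real i * h) \<gamma>)
      / Gamma (2 - \<theta> r (real i * h) \<gamma>) * (u0 (real i * h))\<^sup>2 * h" for \<gamma> r i
  define C where "C \<gamma> r i n = \<omega> r (real i * h) \<gamma>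
      * discrete_caputo \<tau> (\<theta> r (real i * h) \<gamma>) n (\<lambda>s. (y i s)\<^sup>2)" for \<gamma> r i n
  \<comment> \<open>Integrability of each piece justifies splitting the integrals of differences and
    finite sums below.\<close>
  have AB: "(\<lambda>\<gamma>. A \<gamma> r i) integrable_on {\<alpha>..\<beta>} \<and> (\<lambda>\<gamma>. B \<gamma> r i) integrable_on {\<alpha>..\<beta>}
      \<and> (\<forall>n. (\<lambda>\<gamma>. C \<gamma> r i n) integrable_on {\<alpha>..\<beta>})"
    if r: "r \<in> {1..m}" and i: "i \<in> {1..N-1}" for r i
  proof -
    have x: "real i * h \<in> {0..l}" using i by (intro x_mem) auto
    note \<omega> = assms(8)[OF r x] and \<theta> = \<theta>_cont[OF r x]
    have lt: "\<theta> r (real i * h) \<gamma> < 1" if "\<gamma> \<in> {\<alpha>..\<beta>}" for \<gamma>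
      using assms(6)[OF r x that] by simp
    have \<Gamma>: "Gamma (2 - \<theta> r (real i * h) \<gamma>) \<noteq> 0" if "\<gamma> \<in> {\<alpha>..\<beta>}" for \<gamma>
      using Gamma_two_minus_pos[OF lt[OF that]] by simp
    note cont = continuous_intros \<theta> continuous_on_Gamma_two_minus continuous_on_powr_one_minus
    have "(\<lambda>\<gamma>. \<omega> r (real i * h) \<gamma> * (1 / Gamma (2 - \<theta> r (real i * h) \<gamma>)
      * (\<Sum>s=0..j. ((real (j - s + 1) * \<tau>) powr (1 - \<theta> r (real i * h) \<gamma>)
           - (real (j - s) * \<tau>) powr (1 - \<theta> r (real i * h) \<gamma>)) * (y i (s + 1))\<^sup>2) * h))
        integrable_on {\<alpha>..\<beta>}"
      by (intro integrable_mult_continuous_on[OF \<omega>] cont) (use lt \<Gamma> \<tau> in auto)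
    moreover have "(\<lambda>\<gamma>. \<omega> r (real i * h) \<gamma> * ((real (j + 1) * \<tau>) powr (1 - \<theta> r (real i * h) \<gamma>)
      / Gamma (2 - \<theta> r (real i * h) \<gamma>) * (u0 (real i * h))\<^sup>2 * h)) integrable_on {\<alpha>..\<beta>}"
      by (intro integrable_mult_continuous_on[OF \<omega>] cont) (use lt \<Gamma> \<tau> in auto)
    moreover have "\<forall>n. (\<lambda>\<gamma>. C \<gamma> r i n) integrable_on {\<alpha>..\<beta>}"
      unfolding C_def using integrable_mult_discrete_caputo[OF \<omega> \<theta> lt \<tau>] by blast
    ultimately show ?thesis by (simp add: A_def B_def mult_ac)
  qed
  \<comment> \<open>The telescoping in time takes place for fixed \<open>\<gamma>\<close>, before
    integration; the initial condition turns \<open>y i 0\<close> into \<open>u0\<close> in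
    \<open>B\<close>.\<close>
  have pointwise: "A \<gamma> r i - B \<gamma> r i = (\<Sum>n=0..j. C \<gamma> r i n * h * \<tau>)"
    if r: "r \<in> {1..m}" and i: "i \<in> {1..N-1}" and \<gamma>: "\<gamma> \<in> {\<alpha>..\<beta>}" for \<gamma> r i
  proof -
    have x: "real i * h \<in> {0..l}" using i by (intro x_mem) auto
    have lt: "\<theta> r (real i * h) \<gamma> < 1" using assms(6)[OF r x \<gamma>] by simp
    have y0: "y i 0 = u0 (real i * h)" using i by (intro y_0) auto
    have "(\<Sum>n=0..j. C \<gamma> r i n * h * \<tau>)
        = \<omega> r (real i * h) \<gamma> * h * (\<Sum>n=0..j. \<tau> * discrete_caputo \<tau> (\<theta> r (real i * h) \<gamma>) n (\<lambda>s. (y i s)\<^sup>2))"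
      by (simp add: C_def sum_distrib_left mult_ac)
    also have "\<dots> = A \<gamma> r i - B \<gamma> r i"
      unfolding sum_discrete_caputo[OF \<tau> lt] A_def B_def y0
      by (simp add: diff_divide_distrib right_diff_distrib mult_ac)
    finally show ?thesis by simp
  qed
  \<comment> \<open>Interchanging the finite sums with the integral identifies the difference of the
    two weighted terms with the time sum of \<open>P2\<close> in \<open>main\<close>.\<close>
  have "integral {\<alpha>..\<beta>} (\<lambda>\<gamma>. \<Sum>r=1..m. \<Sum>i=1..N-1. A \<gamma> r i)
        - integral {\<alpha>..\<beta>} (\<lambda>\<gamma>. \<Sum>r=1..m. \<Sum>i=1..N-1. B \<gamma> r i)
      = integral {\<alpha>..\<beta>} (\<lambda>\<gamma>. (\<Sum>r=1..m. \<Sum>i=1..N-1. A \<gamma> r i) - (\<Sum>r=1..m. \<Sum>i=1..N-1. B \<gamma> r i))"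
    using AB by (intro integral_diff[symmetric] integrable_sum) auto
  also have "\<dots> = integral {\<alpha>..\<beta>} (\<lambda>\<gamma>. \<Sum>n=0..j. \<Sum>i=1..N-1. (\<Sum>r=1..m. C \<gamma> r i n) * h * \<tau>)"
  proof (rule integral_cong)
    fix \<gamma> assume "\<gamma> \<in> {\<alpha>..\<beta>}"
    then have "(\<Sum>r=1..m. \<Sum>i=1..N-1. A \<gamma> r i) - (\<Sum>r=1..m. \<Sum>i=1..N-1. B \<gamma> r i)
        = (\<Sum>r=1..m. \<Sum>i=1..N-1. \<Sum>n=0..j. C \<gamma> r i n * h * \<tau>)"
      unfolding sum_subtractf[symmetric] by (intro sum.cong refl pointwise) auto
    also have "\<dots> = (\<Sum>i=1..N-1. \<Sum>n=0..j. \<Sum>r=1..m. C \<gamma> r i n * h * \<tau>)"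
      by (subst sum.swap) (intro sum.cong refl sum.swap)
    also have "\<dots> = (\<Sum>n=0..j. \<Sum>i=1..N-1. \<Sum>r=1..m. C \<gamma> r i n * h * \<tau>)"
      by (rule sum.swap)
    finally show "(\<Sum>r=1..m. \<Sum>i=1..N-1. A \<gamma> r i) - (\<Sum>r=1..m. \<Sum>i=1..N-1. B \<gamma> r i)
        = (\<Sum>n=0..j. \<Sum>i=1..N-1. (\<Sum>r=1..m. C \<gamma> r i n) * h * \<tau>)"
      by (simp only: sum_distrib_right)
  qed
  also have "\<dots> = (\<Sum>n=0..j. integral {\<alpha>..\<beta>} (\<lambda>\<gamma>. \<Sum>i=1..N-1. (\<Sum>r=1..m. C \<gamma> r i n) * h * \<tau>))"
    using AB by (intro integral_sum integrable_sum integrable_on_mult_left) auto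
  also have "\<dots> = (\<Sum>n=0..j. \<Sum>i=1..N-1. integral {\<alpha>..\<beta>} (\<lambda>\<gamma>. (\<Sum>r=1..m. C \<gamma> r i n) * h * \<tau>))"
    using AB by (intro sum.cong refl integral_sum integrable_sum integrable_on_mult_left) auto
  also have "\<dots> = (\<Sum>n=0..j. \<Sum>i=1..N-1. P2 n i * h * \<tau>)"
    by (simp add: P2_def discrete_P_def C_def)
  finally have "integral {\<alpha>..\<beta>} (\<lambda>\<gamma>. \<Sum>r=1..m. \<Sum>i=1..N-1. A \<gamma> r i) + c1 * (\<Sum>n=0..j. E n * \<tau>)
      \<le> l\<^sup>2 / (2 * c1) * (\<Sum>n=0..j. F n * \<tau>) + integral {\<alpha>..\<beta>} (\<lambda>\<gamma>. \<Sum>r=1..m. \<Sum>i=1..N-1. B \<gamma> r i)"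
    using main by linarith
  then show "integral {\<alpha>..\<beta>} (\<lambda>\<gamma>. \<Sum>r=1..m.
            ip N h
              (\<lambda>i. \<omega> r (real i * h) \<gamma> / Gamma (2 - \<theta> r (real i * h) \<gamma>))
              (\<lambda>i. \<Sum>s=0..j.
                 ((real (j - s + 1) * \<tau>) powr (1 - \<theta> r (real i * h) \<gamma>)
                   - (real (j - s) * \<tau>) powr (1 - \<theta> r (real i * h) \<gamma>)) * (y i (s + 1))\<^sup>2))
          + c1 * (\<Sum>s=0..j. norm0_right_sq N h (diff_bwd h (\<lambda>i. y i (s + 1))) * \<tau>)
          \<le> l\<^sup>2 / (2 * c1) *
              (\<Sum>s=0..j. norm0_sq N h (\<lambda>i. f (real i * h) (real (s + 1) * \<tau>)) * \<tau>)
            + integral {\<alpha>..\<beta>} (\<lambda>\<gamma>. \<Sum>r=1..m.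
                ip N h
                  (\<lambda>i. \<omega> r (real i * h) \<gamma> * (real (j + 1) * \<tau>) powr (1 - \<theta> r (real i * h) \<gamma>)
                        / Gamma (2 - \<theta> r (real i * h) \<gamma>))
                  (\<lambda>i. (u0 (real i * h))\<^sup>2))"
    unfolding ip_def A_def B_def E_def F_def .
qed

end
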